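(* Let $n\ge 2$ be an integer. The Jacobi sequence of $e^{1/n}$ (where $e$ is Euler's number) is purely periodic, and its smallest period length is $24$ if $n\equiv 1,3\pmod 4$, $12$ if $n\equiv 2\pmod 4$, and $3$ if $n\equiv 0\pmod 4$.
   Context: For $x\in\mathbb{R}\setminus\mathbb{Q}$ with regular continued fraction expansion $x=[a_0,a_1,a_2,\ldots]$, the convergents $s_k/t_k$ are defined by $s_{-1}=1$, $s_0=a_0$, $s_k=a_ks_{k-1}+s_{k-2}$ and $t_{-1}=0$, $t_0=1$, $t_k=a_kt_{k-1}+t_{k-2}$ for $k\ge1$. For an odd natural number $n$ and an integer $m$ coprime to $n$, $\left(\frac{m}{n}\right)$ is the usual Jacobi symbol (equal to $1$ if $n=1$); if $n$ is even and $\gcd(m,n)=1$, one sets $\left(\frac{m}{n}\right)=*$, a fixed symbol different from $\pm1$. The Jacobi sequence of $x$ is $c_k=\left(\frac{s_k}{t_k}\right)$, $k\ge 0$. It is purely periodic with period length $L\ge1$ if $c_{k+L}=c_k$ for all $k\ge0$; the smallest period length is the least such $L$. *)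

theory Defs
  imports Complex_Main "HOL-Number_Theory.Number_Theory"
begin

fun cf_rem :: "real \<Rightarrow> nat \<Rightarrow> real" where
  "cf_rem x 0 = x"
| "cf_rem x (Suc k) = 1 / frac (cf_rem x k)"

definition cf :: "real \<Rightarrow> nat \<Rightarrow> int" where
  "cf x k = \<lfloor>cf_rem x k\<rfloor>"

text \<open>Shifted convergent sequences: cf_num x (Suc k) = s_k, cf_num x 0 = s_(-1) = 1;
  cf_den x (Suc k) = t_k, cf_den x 0 = t_(-1) = 0.\<close>
fun cf_num :: "real \<Rightarrow> nat \<Rightarrow> int" where
  "cf_num x 0 = 1"
| "cf_num x (Suc 0) = cf x 0"
| "cf_num x (Suc (Suc k)) = cf x (Suc k) * cf_num x (Suc k) + cf_num x k"

fun cf_den :: "real \<Rightarrow> nat \<Rightarrow> int" where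
  "cf_den x 0 = 0"
| "cf_den x (Suc 0) = 1"
| "cf_den x (Suc (Suc k)) = cf x (Suc k) * cf_den x (Suc k) + cf_den x k"

definition conv_num :: "real \<Rightarrow> nat \<Rightarrow> int" where
  "conv_num x k = cf_num x (Suc k)"

definition conv_den :: "real \<Rightarrow> nat \<Rightarrow> int" where
  "conv_den x k = cf_den x (Suc k)"

text \<open>Jacobi symbol (m/n) for odd n > 0: product of Legendre symbols over the prime
  factorisation of n (empty product = 1 for n = 1). For even n the value is the extra
  symbol *, encoded as None; the values +-1 are encoded as Some 1, Some (-1).\<close>
definition jacobi_sym :: "int \<Rightarrow> int \<Rightarrow> int option" where
  "jacobi_sym m n =
     (if odd n then Some (\<Prod>p\<in>#prime_factorization (nat n). Legendre m (int p))
      else None)"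

definition jacobi_seq :: "real \<Rightarrow> nat \<Rightarrow> int option" where
  "jacobi_seq x k = jacobi_sym (conv_num x k) (conv_den x k)"

definition is_period :: "(nat \<Rightarrow> 'a) \<Rightarrow> nat \<Rightarrow> bool" where
  "is_period c L \<longleftrightarrow> L \<ge> 1 \<and> (\<forall>k. c (k + L) = c k)"

definition purely_periodic :: "(nat \<Rightarrow> 'a) \<Rightarrow> bool" where
  "purely_periodic c \<longleftrightarrow> (\<exists>L. is_period c L)"

definition smallest_period :: "(nat \<Rightarrow> 'a) \<Rightarrow> nat" where
  "smallest_period c = (LEAST L. is_period c L)"

end

theory Submission
  imports Defs
begin

text \<open>Lambert's expansion of \<open>coth (1/(2n)) = [2n, 6n, 10n, \<dots>]\<close> yields
  \<open>exp (1/n) = [1, n-1, 1, 1, 3n-1, 1, 1, 5n-1, 1, \<dots>]\<close>. Quadratic reciprocity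
  expresses the symbol of \<open>(t\<^sub>k, a t\<^sub>k + t\<^sub>k\<^sub>-\<^sub>1)\<close> through the symbol of \<open>(t\<^sub>k\<^sub>-\<^sub>1, t\<^sub>k)\<close>
  with a sign depending only on \<open>a\<close>, \<open>t\<^sub>k\<^sub>-\<^sub>1\<close> and \<open>t\<^sub>k\<close> modulo 4. Hence the Jacobi sequence is the
  output of a finite automaton driven by the partial quotients modulo 4, which have period 6.
  The automaton is back in its initial state after 24 steps for every residue of \<open>n\<close> modulo 4,
  so a table of 24 values decides the smallest period.\<close>

section \<open>The Jacobi symbol\<close>

definition jac :: "int \<Rightarrow> nat \<Rightarrow> int" where
  "jac m n = (\<Prod>p\<in>#prime_factorization n. Legendre m (int p))"

definition chi4 :: "nat \<Rightarrow> int" where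
  "chi4 n = (if n mod 4 = 3 then -1 else 1)"

definition recip_sign :: "nat \<Rightarrow> nat \<Rightarrow> int" where
  "recip_sign m n = (if m mod 4 = 3 \<and> n mod 4 = 3 then -1 else 1)"

lemma odd_mod4: "odd (n::nat) \<Longrightarrow> n mod 4 = 1 \<or> n mod 4 = 3"
  by presburger

lemma mod4_mult_odd:
  assumes "odd (a::nat)" "odd b"
  shows "(a * b) mod 4 = 3 \<longleftrightarrow> (a mod 4 = 3) \<noteq> (b mod 4 = 3)"
proof -
  have "(a * b) mod 4 = ((a mod 4) * (b mod 4)) mod 4"
    by (simp add: mod_mult_eq)
  then show ?thesis
    using odd_mod4[OF assms(1)] odd_mod4[OF assms(2)] by auto
qed

lemma chi4_mult: "odd a \<Longrightarrow> odd b \<Longrightarrow> chi4 (a * b) = chi4 a * chi4 b"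
  by (auto simp: chi4_def mod4_mult_odd)

lemma recip_sign_commute: "recip_sign a b = recip_sign b a"
  by (auto simp: recip_sign_def)

lemma recip_sign_mult:
  "odd a \<Longrightarrow> odd b \<Longrightarrow> recip_sign m (a * b) = recip_sign m a * recip_sign m b"
  by (auto simp: recip_sign_def mod4_mult_odd)

lemma minus_one_power_half:
  assumes "odd (p::nat)"
  shows "(-1::int) ^ ((p - 1) div 2) = chi4 p"
proof (cases "p mod 4 = 3")
  case True
  then have "odd ((p - 1) div 2)" by presburger
  then show ?thesis using True by (simp add: chi4_def)
next
  case False
  then have "even ((p - 1) div 2)" using assms by presburger
  then show ?thesis using False by (simp add: chi4_def)
qed

text \<open>Peeling off one prime at a time keeps the cofactor odd, so identities for
  \<open>jac\<close> reduce to identities for \<open>Legendre\<close> at odd primes.\<close>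

lemma odd_prime_factor_induct [consumes 1, case_names one mult]:
  assumes "odd (n::nat)"
    and one: "P 1"
    and mult: "\<And>p m. prime p \<Longrightarrow> odd p \<Longrightarrow> odd m \<Longrightarrow> P m \<Longrightarrow> P (p * m)"
  shows "P n"
  using assms(1)
proof (induction n rule: less_induct)
  case (less n)
  show ?case
  proof (cases "n = 1")
    case True
    then show ?thesis using one by (simp only:)
  next
    case False
    then obtain p where p: "prime p" "p dvd n"
      using prime_factor_nat by blast
    then obtain m where m: "n = p * m" by auto
    have "m > 0" "odd p" "odd m" using less.prems m by (auto intro: Nat.gr0I)
    moreover have "m < n" using m p(1) \<open>m > 0\<close> prime_gt_1_nat by simp
    ultimately show ?thesis using mult[OF p(1)] less.IH m by simp
  qed
qed

section \<open>Legendre symbols modulo an odd prime\<close>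

lemma Legendre_values: "Legendre a p \<in> {-1, 0, 1}"
  by (auto simp: Legendre_def)

text \<open>Two such values differ by at most 2, which is less than \<open>p\<close>. This lifts the
  congruence in Euler's criterion to an equality.\<close>

lemma sign_cong_eq:
  assumes "[a = b] (mod p)" "a \<in> {-1, 0, 1}" "b \<in> {-1, 0, 1}" "p > (2::int)"
  shows "a = b"
proof -
  have "p dvd a - b" using assms(1) by (simp add: cong_iff_dvd_diff)
  moreover have "\<bar>a - b\<bar> < p" using assms by auto
  ultimately have "a - b = 0" using dvd_imp_le_int[of "a - b" p] assms(4) by linarith
  then show ?thesis by simp
qed

lemma odd_prime_gt_2: "prime (p::nat) \<Longrightarrow> odd p \<Longrightarrow> p > 2"
  using prime_ge_2_nat[of p] by (cases "p = 2") auto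

lemma Legendre_mult:
  assumes "prime p" "odd p"
  shows "Legendre (a * b) (int p) = Legendre a (int p) * Legendre b (int p)"
proof (rule sign_cong_eq)
  have p2: "2 < p" using assms by (rule odd_prime_gt_2)
  then show "int p > 2" by simp
  have E: "[Legendre x (int p) = x ^ ((p - 1) div 2)] (mod int p)" for x
    using euler_criterion assms(1) p2 by blast
  have "[Legendre a (int p) * Legendre b (int p) = (a * b) ^ ((p - 1) div 2)] (mod int p)"
    unfolding power_mult_distrib by (intro cong_mult E)
  then show "[Legendre (a * b) (int p) = Legendre a (int p) * Legendre b (int p)] (mod int p)"
    using E cong_sym cong_trans by blast
  show "Legendre a (int p) * Legendre b (int p) \<in> {-1, 0, 1}"
    using Legendre_values[of a "int p"] Legendre_values[of b "int p"] by auto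
qed (rule Legendre_values)

lemma Legendre_minus_one:
  assumes "prime p" "odd p"
  shows "Legendre (-1) (int p) = chi4 p"
proof (rule sign_cong_eq)
  have p2: "2 < p" using assms by (rule odd_prime_gt_2)
  then show "int p > 2" by simp
  show "[Legendre (-1) (int p) = chi4 p] (mod int p)"
    using euler_criterion[OF assms(1) p2, of "-1"] minus_one_power_half[OF assms(2)] by simp
qed (use Legendre_values in \<open>auto simp: chi4_def\<close>)

lemma Legendre_cong:
  assumes "[a = b] (mod p)"
  shows "Legendre a p = Legendre b p"
proof -
  have "[a = 0] (mod p) \<longleftrightarrow> [b = 0] (mod p)"
    using assms cong_sym cong_trans by blast
  moreover have "QuadRes p a \<longleftrightarrow> QuadRes p b"
    unfolding QuadRes_def using assms cong_sym cong_trans by blast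
  ultimately show ?thesis by (simp add: Legendre_def)
qed

lemma Legendre_one: "prime p \<Longrightarrow> Legendre 1 (int p) = 1"
  using prime_gt_1_nat[of p]
  by (auto simp: Legendre_def QuadRes_def cong_def intro!: exI[of _ 1])

lemma Legendre_reciprocity:
  assumes "prime p" "odd p" "prime q" "odd q"
  shows "Legendre (int p) (int q) = recip_sign p q * Legendre (int q) (int p)"
proof (cases "p = q")
  case True
  then have "Legendre (int p) (int q) = 0" by (simp add: Legendre_def cong_def)
  then show ?thesis using True by simp
next
  case False
  have "Legendre p q * Legendre q p = ((-1::int) ^ ((p - 1) div 2)) ^ ((q - 1) div 2)"
    using Quadratic_Reciprocity[of p q] False assms odd_prime_gt_2 by (simp add: power_mult)
  also have "\<dots> = recip_sign p q"
    unfolding minus_one_power_half[OF assms(2)] using minus_one_power_half[OF assms(4)]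
    by (auto simp: chi4_def recip_sign_def)
  finally have *: "Legendre p q * Legendre q p = recip_sign p q" .
  \<comment> \<open>The product is a sign, so neither factor vanishes; a nonzero symbol is its own
    inverse and can be moved across.\<close>
  have "Legendre q p \<noteq> 0"
    using * by (auto simp: recip_sign_def split: if_splits)
  then have "Legendre q p * Legendre q p = 1"
    using Legendre_values[of "int q" "int p"] by auto
  then show ?thesis using * by (metis mult.assoc mult.right_neutral)
qed

section \<open>Jacobi symbols: multiplicativity, the value at -1, reciprocity\<close>

lemma jac_one_right [simp]: "jac m (Suc 0) = 1"
  by (simp add: jac_def)

lemma jac_prime_mult: "prime p \<Longrightarrow> odd n \<Longrightarrow> jac m (p * n) = Legendre m (int p) * jac m n"
  by (cases "n = 0") (auto simp: jac_def prime_factorization_mult prime_factorization_prime)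

lemma jac_mult: "odd n \<Longrightarrow> jac (a * b) n = jac a n * jac b n"
  by (induction n rule: odd_prime_factor_induct) (simp_all add: jac_prime_mult Legendre_mult)

lemma jac_one_left: "odd n \<Longrightarrow> jac 1 n = 1"
  by (induction n rule: odd_prime_factor_induct)
    (simp_all add: jac_prime_mult Legendre_one)

lemma jac_minus_one: "odd n \<Longrightarrow> jac (-1) n = chi4 n"
proof (induction n rule: odd_prime_factor_induct)
  case one
  then show ?case by (simp add: chi4_def)
qed (simp_all add: jac_prime_mult Legendre_minus_one chi4_mult)

lemma jac_cong:
  assumes "odd n" "[a = b] (mod int n)"
  shows "jac a n = jac b n"
  using assms
proof (induction n rule: odd_prime_factor_induct)
  case (mult p m)
  then have "[a = b] (mod int p)" "[a = b] (mod int m)"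
    by (auto simp: cong_iff_dvd_diff intro: dvd_mult_left dvd_mult_right)
  then show ?case using mult by (simp add: jac_prime_mult Legendre_cong)
qed simp

text \<open>Reciprocity is extended one argument at a time: here \<open>n\<close> is factored with
  the prime \<open>p\<close> fixed, then \<open>jac_reciprocity\<close> factors the other
  argument.\<close>

lemma jac_reciprocity_prime:
  assumes "odd n" "prime p" "odd p"
  shows "Legendre (int n) (int p) = recip_sign n p * jac (int p) n"
  using assms
proof (induction n rule: odd_prime_factor_induct)
  case one
  then show ?case by (simp add: recip_sign_def Legendre_one)
next
  case (mult q m)
  then show ?case
    by (simp add: jac_prime_mult Legendre_mult Legendre_reciprocity[of q p]
        recip_sign_mult recip_sign_commute[of _ p])
qed

lemma jac_reciprocity:
  assumes "odd m" "odd n"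
  shows "jac (int m) n = recip_sign m n * jac (int n) m"
  using assms(2,1)
proof (induction n rule: odd_prime_factor_induct)
  case one
  then show ?case using jac_one_left[of m] by (simp add: recip_sign_def)
next
  case (mult p k)
  then show ?case
    by (simp add: jac_prime_mult jac_mult jac_reciprocity_prime recip_sign_mult)
qed

section \<open>The symbol of consecutive denominators\<close>

text \<open>For an even modulus the two arguments trade places; this keeps the symbol defined for
  every coprime pair, so that it can be followed along the Euclidean algorithm.\<close>

definition esym :: "nat \<Rightarrow> nat \<Rightarrow> int" where
  "esym m n = (if odd n then jac (int m) n else jac (int n) m)"

text \<open>The sign acquired when \<open>(m, n)\<close> becomes \<open>(m, n + m)\<close>. The
  branches are the parity patterns with an odd entry; the last one is meant for even
  \<open>m\<close> and odd \<open>n\<close>.\<close>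

definition add_sign :: "nat \<Rightarrow> nat \<Rightarrow> int" where
  "add_sign m n =
     (if odd m \<and> odd n then recip_sign m n
      else if odd m then recip_sign m (n + m)
      else chi4 (n + m) * recip_sign n (n + m))"

lemma esym_swap:
  assumes "odd m \<or> odd n"
  shows "esym n m = recip_sign m n * esym m n"
proof (cases "odd m \<and> odd n")
  case True
  then show ?thesis
    using jac_reciprocity[of n m] by (simp add: esym_def recip_sign_commute)
next
  case False
  then have "\<not> (m mod 4 = 3 \<and> n mod 4 = 3)" by presburger
  then have "recip_sign m n = 1" by (simp add: recip_sign_def)
  then show ?thesis using False assms by (auto simp: esym_def)
qed

lemma jac_add_self: "odd m \<Longrightarrow> jac (int (n + m)) m = jac (int n) m"
  by (rule jac_cong) (simp_all add: cong_def)

lemma esym_add: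
  assumes "odd m \<or> odd n"
  shows "esym m (n + m) = add_sign m n * esym m n"
proof -
  consider "odd m" "odd n" | "odd m" "even n" | "even m" "odd n" using assms by blast
  then show ?thesis
  proof cases
    case 1
    then show ?thesis
      using jac_add_self[of m n] jac_reciprocity[of n m]
      by (simp add: esym_def add_sign_def recip_sign_commute)
  next
    case 2
    then show ?thesis
      using jac_add_self[of m n] jac_reciprocity[of m "n + m"]
      by (simp add: esym_def add_sign_def)
  next
    case 3
    \<comment> \<open>Replacing the even \<open>m\<close> by \<open>-n\<close> avoids the symbol of 2, which would require residues modulo 8.\<close>
    have "jac (int m) (n + m) = jac (-1 * int n) (n + m)"
      using 3 by (intro jac_cong) (simp_all add: cong_iff_dvd_diff add.commute)
    also have "\<dots> = chi4 (n + m) * jac (int n) (n + m)"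
      using 3 jac_minus_one[of "n + m"] jac_mult[of "n + m" "-1" "int n"] by simp
    also have "jac (int n) (n + m) = recip_sign n (n + m) * jac (int (n + m)) n"
      using 3 by (intro jac_reciprocity) simp_all
    also have "jac (int (n + m)) n = jac (int m) n"
      using 3 jac_add_self[of n m] by (simp add: add.commute)
    finally show ?thesis using 3 by (simp add: esym_def add_sign_def)
  qed
qed

section \<open>Reduction of the Euclidean steps modulo 4\<close>

type_synonym state = "nat \<times> nat \<times> int"

definition sig :: "nat \<Rightarrow> nat \<Rightarrow> state" where
  "sig m n = (m mod 4, n mod 4, esym m n)"

fun add_state :: "state \<Rightarrow> state" where
  "add_state (m, n, s) = (m, (n + m) mod 4, add_sign m n * s)"

fun swap_state :: "state \<Rightarrow> state" where
  "swap_state (m, n, s) = (n, m, recip_sign m n * s)"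

text \<open>The step from \<open>(m, n)\<close> to \<open>(n, a * n + m)\<close>: a swap, then
  \<open>a\<close> additions of the new first entry.\<close>

definition cf_step :: "nat \<Rightarrow> state \<Rightarrow> state" where
  "cf_step a st = (add_state ^^ a) (swap_state st)"

lemma recip_sign_mod: "recip_sign (m mod 4) (n mod 4) = recip_sign m n"
  by (simp add: recip_sign_def)

lemma add_sign_mod: "add_sign (m mod 4) (n mod 4) = add_sign m n"
proof -
  have "odd (m mod 4) = odd m" "odd (n mod 4) = odd n" by presburger+
  moreover have "(n mod 4 + m mod 4) mod 4 = (n + m) mod 4" by presburger
  ultimately show ?thesis
    by (simp add: add_sign_def recip_sign_def chi4_def)
qed

lemma swap_state_sig: "odd m \<or> odd n \<Longrightarrow> swap_state (sig m n) = sig n m"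
  by (simp add: sig_def recip_sign_mod esym_swap)

lemma add_state_sig: "odd m \<or> odd n \<Longrightarrow> add_state (sig m n) = sig m (n + m)"
  by (simp add: sig_def add_sign_mod esym_add mod_add_eq)

lemma add_state_power_sig:
  "odd m \<or> odd n \<Longrightarrow> (add_state ^^ a) (sig m n) = sig m (n + a * m)"
proof (induction a)
  case (Suc a)
  have "odd m \<or> odd (n + a * m)" using Suc.prems by auto
  then show ?case using Suc add_state_sig[of m "n + a * m"] by (simp add: add_ac)
qed simp

text \<open>Four additions restore both residues, and running through the residue pairs shows that
  the accumulated signs cancel. Hence a partial quotient matters only modulo 4.\<close>

lemma add_state_period:
  assumes "odd m \<or> odd n"
  shows "(add_state ^^ 4) (sig m n) = sig m n"
proof -
  have "(add_state ^^ 4) (a, b, s) = (a, b, s)"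
    if "a \<in> {0, 1, 2, 3}" "b \<in> {0, 1, 2, 3}" "odd a \<or> odd b" for a b s
  proof -
    have "(add_state ^^ 4) x = add_state (add_state (add_state (add_state x)))" for x
      by (simp add: numeral_eq_Suc)
    then show ?thesis
      using that
      by (elim insertE emptyE) (simp_all add: add_sign_def recip_sign_def chi4_def)
  qed
  moreover have "m mod 4 \<in> {0, 1, 2, 3}" "n mod 4 \<in> {0, 1, 2, 3}" by auto
  moreover have "odd (m mod 4) \<or> odd (n mod 4)" using assms by presburger
  ultimately show ?thesis by (simp add: sig_def)
qed

lemma cf_step_sig:
  assumes "odd m \<or> odd n"
  shows "cf_step (a mod 4) (sig m n) = sig n (a * n + m)"
proof -
  have *: "(add_state ^^ (4 * k)) (sig n m) = sig n m" for k
  proof (induction k)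
    case (Suc k)
    have "(add_state ^^ 4) (sig n m) = sig n m" using assms add_state_period by blast
    then show ?case using Suc by (simp only: mult_Suc_right funpow_add comp_apply)
  qed simp
  have "(add_state ^^ a) (sig n m) = (add_state ^^ (a mod 4)) ((add_state ^^ (4 * (a div 4))) (sig n m))"
    by (metis comp_apply funpow_add mod_mult_div_eq)
  also have "\<dots> = (add_state ^^ (a mod 4)) (sig n m)" by (simp only: *)
  finally show ?thesis
    using assms add_state_power_sig[of n m a]
    by (auto simp: cf_step_def swap_state_sig add.commute)
qed

section \<open>The continued fraction of exp (1/n)\<close>

text \<open>\<open>lam y 0 = cosh y\<close> and \<open>lam y k\<close> is, up to a power of \<open>y\<close>, a modified Bessel function of
  half-integer order; the recurrence \<open>lam_rec\<close> produces Lambert's continued fraction.\<close>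

definition lam_coeff :: "nat \<Rightarrow> nat \<Rightarrow> real" where
  "lam_coeff k j = 2 ^ k * fact (k + j) / (fact j * fact (2 * (k + j)))"

definition lam :: "real \<Rightarrow> nat \<Rightarrow> real" where
  "lam y k = (\<Sum>j. lam_coeff k j * y ^ (2 * j))"

lemma lam_coeff_pos: "lam_coeff k j > 0"
  by (simp add: lam_coeff_def)

lemma lam_coeff_le: "lam_coeff k j \<le> 2 ^ k / fact j"
proof -
  have "fact (k + j) \<le> (fact (2 * (k + j)) :: real)"
    by (rule fact_mono) simp
  then show ?thesis
    by (simp add: lam_coeff_def divide_simps mult_left_mono)
qed

lemma summable_lam: "summable (\<lambda>j. lam_coeff k j * y ^ (2 * j))"
proof (rule summable_comparison_test)
  have "norm (lam_coeff k j * y ^ (2 * j)) \<le> 2 ^ k * ((y ^ 2) ^ j /\<^sub>R fact j)" for j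
  proof -
    have "norm (lam_coeff k j * y ^ (2 * j)) = lam_coeff k j * (y ^ 2) ^ j"
      unfolding power_mult using lam_coeff_pos[of k j] by (simp add: abs_mult power_abs)
    also have "\<dots> \<le> 2 ^ k / fact j * (y ^ 2) ^ j"
      by (intro mult_right_mono lam_coeff_le) simp
    finally show ?thesis by (simp add: field_simps)
  qed
  then show "\<exists>N. \<forall>j\<ge>N. norm (lam_coeff k j * y ^ (2 * j)) \<le> 2 ^ k * ((y ^ 2) ^ j /\<^sub>R fact j)"
    by blast
  show "summable (\<lambda>j. 2 ^ k * ((y ^ 2) ^ j /\<^sub>R fact j))"
    by (intro summable_mult summable_exp_generic)
qed

lemma lam_pos:
  assumes "y > 0"
  shows "lam y k > 0"
  unfolding lam_def by (rule suminf_pos[OF summable_lam]) (simp add: assms lam_coeff_pos)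

text \<open>Compares coefficients of \<open>y ^ (2 * Suc j)\<close> in \<open>lam_rec\<close>; the
  factor \<open>y ^ 2\<close> there accounts for the index \<open>j\<close> in the last
  term.\<close>

lemma lam_coeff_rec:
  "lam_coeff k (Suc j) = (2 * real k + 1) * lam_coeff (Suc k) (Suc j) + lam_coeff (Suc (Suc k)) j"
proof -
  define N where "N = k + j"
  have F: "fact (Suc (Suc N)) = (real N + 2) * (real N + 1) * fact N"
    "fact (Suc N) = (real N + 1) * fact N"
    "fact (2 * Suc N) = (2 * real N + 2) * (2 * real N + 1) * fact (2 * N)"
    "fact (2 * Suc (Suc N)) =
      (2 * real N + 4) * (2 * real N + 3) * (2 * real N + 2) * (2 * real N + 1) * fact (2 * N)"
    by (simp_all add: algebra_simps)
  have L: "lam_coeff k (Suc j) = 2 ^ k * fact (Suc N) / ((real j + 1) * fact j * fact (2 * Suc N))"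
    "lam_coeff (Suc k) (Suc j) = 2 * 2 ^ k * fact (Suc (Suc N)) / ((real j + 1) * fact j * fact (2 * Suc (Suc N)))"
    "lam_coeff (Suc (Suc k)) j = 4 * 2 ^ k * fact (Suc (Suc N)) / (fact j * fact (2 * Suc (Suc N)))"
    by (simp_all add: lam_coeff_def N_def add.commute del: mult_Suc_right)
  have A:
    "lam_coeff k (Suc j) = 2 ^ k * ((real N + 1) * fact N) / ((real j + 1) * fact j * ((2 * real N + 2) * (2 * real N + 1) * fact (2 * N)))"
    "lam_coeff (Suc k) (Suc j) = 2 * 2 ^ k * ((real N + 2) * (real N + 1) * fact N) / ((real j + 1) * fact j * ((2 * real N + 4) * (2 * real N + 3) * (2 * real N + 2) * (2 * real N + 1) * fact (2 * N)))"
    "lam_coeff (Suc (Suc k)) j = 4 * 2 ^ k * ((real N + 2) * (real N + 1) * fact N) / (fact j * ((2 * real N + 4) * (2 * real N + 3) * (2 * real N + 2) * (2 * real N + 1) * fact (2 * N)))"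
    by (simp_all only: L F)
  \<comment> \<open>A common factor of the three coefficients. Dividing it out leaves the linear
    identity \<open>2 * k + 1 + 2 * (j + 1) = 2 * N + 3\<close>.\<close>
  define Z where "Z = 2 ^ k * fact N / (fact j * fact (2 * N) * (2 * (2 * real N + 1)))"
  have Z: "lam_coeff k (Suc j) = Z / (real j + 1)"
    "lam_coeff (Suc k) (Suc j) = Z / ((real j + 1) * (2 * real N + 3))"
    "lam_coeff (Suc (Suc k)) j = 2 * Z / (2 * real N + 3)"
    unfolding A Z_def by (simp add: divide_simps, simp add: algebra_simps)+
  have "(2 * real k + 1) * (Z / ((real j + 1) * (2 * real N + 3))) + 2 * Z / (2 * real N + 3)
      = (Z * (2 * real k + 1 + 2 * (real j + 1))) / ((real j + 1) * (2 * real N + 3))"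
    by (simp add: divide_simps) (simp add: algebra_simps)
  also have "2 * real k + 1 + 2 * (real j + 1) = 2 * real N + 3"
    by (simp add: N_def)
  also have "(Z * (2 * real N + 3)) / ((real j + 1) * (2 * real N + 3)) = Z / (real j + 1)"
    by (simp add: divide_simps)
  finally show ?thesis unfolding Z by simp
qed

lemma lam_coeff_rec_0: "lam_coeff k 0 = (2 * real k + 1) * lam_coeff (Suc k) 0"
proof -
  have "fact (2 * Suc k) = (2 * real k + 2) * (2 * real k + 1) * fact (2 * k)"
    by (simp add: algebra_simps)
  moreover have "lam_coeff (Suc k) 0 = 2 * 2 ^ k * ((real k + 1) * fact k) / fact (2 * Suc k)"
    by (simp add: lam_coeff_def add.commute del: mult_Suc_right)
  ultimately show ?thesis
    by (simp add: lam_coeff_def divide_simps del: mult_Suc_right)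
qed

lemma lam_rec: "lam y k = (2 * real k + 1) * lam y (Suc k) + y ^ 2 * lam y (Suc (Suc k))"
proof -
  let ?s = "\<lambda>k j. lam_coeff k j * y ^ (2 * j)"
  have split: "lam y i = lam_coeff i 0 + (\<Sum>j. ?s i (Suc j))" for i
    using suminf_split_head[OF summable_lam[of i y]] by (simp add: lam_def)
  have sum: "summable (\<lambda>j. ?s i (Suc j))" for i
    using summable_lam[of i y] summable_Suc_iff[of "?s i"] by blast
  have "(\<Sum>j. ?s k (Suc j)) = (\<Sum>j. (2 * real k + 1) * ?s (Suc k) (Suc j) + y ^ 2 * ?s (Suc (Suc k)) j)"
    by (rule suminf_cong) (simp add: lam_coeff_rec[of k] algebra_simps power2_eq_square)
  also have "\<dots> = (2 * real k + 1) * (\<Sum>j. ?s (Suc k) (Suc j)) + y ^ 2 * lam y (Suc (Suc k))"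
    unfolding lam_def
    by (subst suminf_add[symmetric])
      (simp_all only: suminf_mult[OF sum] suminf_mult[OF summable_lam] summable_mult[OF sum] summable_mult[OF summable_lam])
  finally show ?thesis
    using split[of k] split[of "Suc k"] lam_coeff_rec_0[of k] by (simp add: algebra_simps)
qed

lemma lam_0: "lam y 0 = cosh y"
proof -
  have "(\<lambda>j. if even j then y ^ j /\<^sub>R fact j else 0) sums cosh y"
    by (rule cosh_converges)
  then have "(\<lambda>j. y ^ (2 * j) /\<^sub>R fact (2 * j)) sums cosh y"
    by (subst (asm) sums_mono_reindex[of "\<lambda>j. 2 * j", symmetric]) (auto simp: strict_mono_def elim!: evenE)
  then show ?thesis
    by (simp add: lam_def lam_coeff_def sums_iff field_simps)
qed

lemma lam_1: "y * lam y (Suc 0) = sinh y"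
proof -
  have "(\<lambda>j. if even j then 0 else y ^ j /\<^sub>R fact j) sums sinh y"
    by (rule sinh_converges)
  then have sums: "(\<lambda>j. y ^ (2 * j + 1) /\<^sub>R fact (2 * j + 1)) sums sinh y"
    by (subst (asm) sums_mono_reindex[of "\<lambda>j. 2 * j + 1", symmetric]) (auto simp: strict_mono_def elim!: oddE)
  have eq: "y ^ (2 * j + 1) /\<^sub>R fact (2 * j + 1) = y * (lam_coeff 1 j * y ^ (2 * j))" for j
  proof -
    have "lam_coeff 1 j = 2 * ((real j + 1) * fact j) / (fact j * ((2 * real j + 2) * fact (2 * j + 1)))"
      by (simp add: lam_coeff_def add.commute)
    then show ?thesis by (simp add: divide_simps del: fact_Suc)
  qed
  have "(\<lambda>j. y * (lam_coeff 1 j * y ^ (2 * j))) sums sinh y"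
    using sums unfolding eq .
  then show ?thesis
    by (simp add: lam_def sums_iff suminf_mult summable_lam)
qed

text \<open>The complete quotients of \<open>[2n, 6n, 10n, \<dots>]\<close>; \<open>rho\<close> below gives those of
  \<open>exp (1/n)\<close> at the indices \<open>3k + 1\<close>.\<close>

definition theta :: "nat \<Rightarrow> nat \<Rightarrow> real" where
  "theta n k = 2 * real n * lam (1 / (2 * real n)) k / lam (1 / (2 * real n)) (Suc k)"

lemma theta_pos: "n > 0 \<Longrightarrow> theta n k > 0"
  by (simp add: theta_def lam_pos)

lemma theta_rec:
  assumes "n > 0"
  shows "theta n k = (4 * real k + 2) * real n + 1 / theta n (Suc k)"
proof -
  let ?y = "1 / (2 * real n)"
  have "lam ?y (Suc k) > 0" "lam ?y (Suc (Suc k)) > 0"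
    using assms by (simp_all add: lam_pos)
  then show ?thesis
    using assms lam_rec[of ?y k] by (simp add: theta_def field_simps power2_eq_square)
qed

lemma theta_gt:
  assumes "n > 0"
  shows "theta n k > (4 * real k + 2) * real n"
  using theta_rec[OF assms, of k] theta_pos[OF assms, of "Suc k"] by simp

text \<open>By \<open>lam_0\<close> and \<open>lam_1\<close>, \<open>theta n 0\<close> is
  \<open>coth (1 / (2 * n))\<close>; expanding the fraction by \<open>exp (1 / (2 * n))\<close>
  leaves only \<open>exp (1 / n)\<close>.\<close>

lemma theta_0:
  assumes "n > 0"
  shows "theta n 0 = (exp (1 / real n) + 1) / (exp (1 / real n) - 1)"
proof -
  let ?y = "1 / (2 * real n)"
  have divide_half: "(a / 2) / (b / 2) = a / b" for a b :: real
    by simp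
  have *: "exp (1 / real n) = exp ?y * exp ?y"
    by (simp flip: exp_add)
  have "theta n 0 = cosh ?y / sinh ?y"
    using lam_1[of ?y, symmetric] by (simp add: theta_def lam_0)
  also have "\<dots> = (exp ?y + exp (- ?y)) / (exp ?y - exp (- ?y))"
    unfolding cosh_field_def sinh_field_def by (rule divide_half)
  also have "\<dots> = (exp ?y * (exp ?y + exp (- ?y))) / (exp ?y * (exp ?y - exp (- ?y)))"
    by simp
  also have "\<dots> = (exp (1 / real n) + 1) / (exp (1 / real n) - 1)"
    unfolding * by (simp add: algebra_simps flip: exp_add)
  finally show ?thesis .
qed

definition rho :: "nat \<Rightarrow> nat \<Rightarrow> real" where
  "rho n k = (theta n k - 1) / 2"

lemma rho_gt_1: "n \<ge> 2 \<Longrightarrow> rho n k > 1"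
proof -
  assume n: "n \<ge> 2"
  \<comment> \<open>For \<open>n = 1\<close> the quotient \<open>n - 1\<close> would be 0;
    \<open>n \<ge> 2\<close> gives \<open>theta n k > 4\<close>.\<close>
  then have "(4 * real k + 2) * real n \<ge> 2 * 2" by (intro mult_mono) auto
  then show ?thesis using theta_gt[of n k] n by (simp add: rho_def)
qed

text \<open>Halves \<open>theta_rec\<close>. With \<open>r = rho n (Suc k)\<close> the remainder is
  \<open>1 / (1 + 1 / (1 + 1 / r))\<close>, the source of the two quotients 1 in each block.\<close>

lemma rho_rec:
  assumes "n \<ge> 2"
  shows "rho n k = of_int ((2 * int k + 1) * int n - 1)
    + (rho n (Suc k) + 1) / (2 * rho n (Suc k) + 1)"
proof -
  have "theta n (Suc k) > 0" using assms by (simp add: theta_pos)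
  then show ?thesis
    using theta_rec[of n k] assms by (simp add: rho_def field_simps)
qed

lemma rho_0: "n \<ge> 2 \<Longrightarrow> exp (1 / real n) = 1 + 1 / rho n 0"
proof -
  assume n: "n \<ge> 2"
  then have "exp (1 / real n) > 1" by simp
  then have *: "theta n 0 - 1 = 2 / (exp (1 / real n) - 1)"
    using n by (simp add: theta_0 divide_simps)
  show ?thesis by (simp add: rho_def * diff_divide_distrib)
qed

section \<open>Reading off the partial quotients\<close>

lemma floor_frac_eqI:
  fixes z r :: real
  assumes "z = of_int a + r" "0 \<le> r" "r < 1"
  shows "\<lfloor>z\<rfloor> = a" "frac z = r"
  using assms by (simp_all add: floor_unique frac_unique_iff)

text \<open>The successive fractional parts are \<open>(r + 1) / (2 * r + 1)\<close>,
  \<open>r / (r + 1)\<close> and \<open>1 / r\<close>; \<open>r > 1\<close> puts them all below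
  1.\<close>

lemma cf_rem_exp_step:
  assumes "n \<ge> 2" "cf_rem x (3 * k + 1) = rho n k"
  shows "cf x (3 * k + 1) = (2 * int k + 1) * int n - 1"
    "cf x (3 * k + 2) = 1" "cf x (3 * k + 3) = 1"
    "cf_rem x (3 * k + 4) = rho n (Suc k)"
proof -
  define r where "r = rho n (Suc k)"
  have r: "r > 1" using rho_gt_1 assms(1) by (simp add: r_def)
  have 1: "cf_rem x (3 * k + 1) = of_int ((2 * int k + 1) * int n - 1) + (r + 1) / (2 * r + 1)"
    unfolding assms(2) r_def by (rule rho_rec[OF assms(1)])
  have b1: "0 \<le> (r + 1) / (2 * r + 1)" "(r + 1) / (2 * r + 1) < 1"
    using r by simp_all
  note f1 = floor_frac_eqI[OF 1 b1]
  have "cf_rem x (3 * k + 2) = 1 / frac (cf_rem x (3 * k + 1))"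
    using cf_rem.simps(2)[of x "3 * k + 1"] by (simp del: cf_rem.simps)
  then have 2: "cf_rem x (3 * k + 2) = of_int 1 + r / (r + 1)"
    unfolding f1(2) using r by (simp add: field_simps del: cf_rem.simps)
  have b2: "0 \<le> r / (r + 1)" "r / (r + 1) < 1"
    using r by simp_all
  note f2 = floor_frac_eqI[OF 2 b2]
  have "cf_rem x (3 * k + 3) = 1 / frac (cf_rem x (3 * k + 2))"
    using cf_rem.simps(2)[of x "3 * k + 2"] by (simp add: numeral_3_eq_3 del: cf_rem.simps)
  then have 3: "cf_rem x (3 * k + 3) = of_int 1 + 1 / r"
    unfolding f2(2) using r by (simp add: field_simps del: cf_rem.simps)
  have b3: "0 \<le> 1 / r" "1 / r < 1"
    using r by simp_all
  note f3 = floor_frac_eqI[OF 3 b3]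
  have "cf_rem x (3 * k + 4) = 1 / frac (cf_rem x (3 * k + 3))"
    using cf_rem.simps(2)[of x "3 * k + 3"] by (simp add: numeral_eq_Suc del: cf_rem.simps)
  then show "cf_rem x (3 * k + 4) = rho n (Suc k)"
    unfolding f3(2) by (simp add: r_def del: cf_rem.simps)
  show "cf x (3 * k + 1) = (2 * int k + 1) * int n - 1" "cf x (3 * k + 2) = 1" "cf x (3 * k + 3) = 1"
    unfolding cf_def by (fact f1 f2 f3)+
qed

lemma cf_exp_0:
  assumes "n \<ge> 2"
  shows "cf (exp (1 / real n)) 0 = 1" "cf_rem (exp (1 / real n)) 1 = rho n 0"
proof -
  have "exp (1 / real n) = of_int 1 + 1 / rho n 0" using rho_0[OF assms] by simp
  from floor_frac_eqI[OF this] show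
    "cf (exp (1 / real n)) 0 = 1" "cf_rem (exp (1 / real n)) 1 = rho n 0"
    using rho_gt_1[OF assms, of 0] by (simp_all add: cf_def)
qed

lemma cf_rem_exp: "n \<ge> 2 \<Longrightarrow> cf_rem (exp (1 / real n)) (3 * k + 1) = rho n k"
proof (induction k)
  case 0
  then show ?case using cf_exp_0 by simp
next
  case (Suc k)
  then show ?case
    using cf_rem_exp_step(4)[of n "exp (1 / real n)" k] by (simp add: add.commute[of _ 4] del: cf_rem.simps)
qed

definition pquot :: "nat \<Rightarrow> nat \<Rightarrow> nat" where
  "pquot n k = (if k mod 3 = 1 then (2 * (k div 3) + 1) * n - 1 else 1)"

lemma cf_exp:
  assumes "n \<ge> 2"
  shows "cf (exp (1 / real n)) k = int (pquot n k)"
proof (cases "k = 0")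
  case True
  then show ?thesis using cf_exp_0[OF assms] by (simp add: pquot_def)
next
  case False
  \<comment> \<open>Index 0 precedes the blocks of three, hence the shift by one.\<close>
  define j where "j = (k - 1) div 3"
  have "k = 3 * j + 1 \<or> k = 3 * j + 2 \<or> k = 3 * j + 3"
    unfolding j_def using False by presburger
  moreover have "int ((2 * j + 1) * n - 1) = (2 * int j + 1) * int n - 1"
    using assms by (subst of_nat_diff) (simp_all add: algebra_simps)
  moreover have "(3 * j + 1) mod 3 = 1" "(3 * j + 2) mod 3 = 2" "(3 * j + 3) mod 3 = 0"
    "(3 * j + 1) div 3 = j"
    by presburger+
  ultimately show ?thesis
    using cf_rem_exp_step[OF assms cf_rem_exp[OF assms, of j]]
    by (auto simp: pquot_def simp del: cf_rem.simps)
qed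


section \<open>The Jacobi sequence as the output of an automaton\<close>

text \<open>Indices are shifted as in \<^const>\<open>cf_den\<close>: \<open>cden a (Suc k)\<close> is \<open>t\<^sub>k\<close>.\<close>

fun cden :: "(nat \<Rightarrow> nat) \<Rightarrow> nat \<Rightarrow> nat" where
  "cden a 0 = 0"
| "cden a (Suc 0) = 1"
| "cden a (Suc (Suc k)) = a (Suc k) * cden a (Suc k) + cden a k"

lemma cf_den_eq_cden:
  assumes "\<And>k. cf x k = int (a k)"
  shows "cf_den x k = int (cden a k)"
  using assms by (induction a k rule: cden.induct) simp_all

text \<open>Two even neighbours would force evenness all the way back to
  \<open>cden a 1 = 1\<close>. This supplies the parity condition of
  \<open>cf_step_sig\<close>.\<close>

lemma cden_consecutive_odd: "odd (cden a k) \<or> odd (cden a (Suc k))"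
  by (induction k) auto

text \<open>Unshifted: \<open>s_k t_(k-1) - s_(k-1) t_k = -(-1)^k\<close>. So modulo
  \<open>t_k\<close> the product \<open>s_k t_(k-1)\<close> is -1 for even \<open>k\<close> and 1
  for odd \<open>k\<close>.\<close>

lemma cf_determinant:
  "cf_num x (Suc k) * cf_den x k - cf_num x k * cf_den x (Suc k) = - ((-1) ^ k)"
  by (induction k) (simp_all add: algebra_simps)

text \<open>The initial state encodes \<open>t_(-1) = 0\<close> and \<open>t_0 = 1\<close>, with
  symbol 1.\<close>

fun run :: "(nat \<Rightarrow> nat) \<Rightarrow> nat \<Rightarrow> state" where
  "run b 0 = (0, 1, 1)"
| "run b (Suc k) = cf_step (b (Suc k)) (run b k)"

lemma run_eq_sig: "run (\<lambda>k. a k mod 4) k = sig (cden a k) (cden a (Suc k))"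
proof (induction k)
  case 0
  then show ?case by (simp add: sig_def esym_def)
next
  case (Suc k)
  then show ?case using cf_step_sig[OF cden_consecutive_odd] by simp
qed

text \<open>For odd \<open>t\<close> the state holds the symbol of \<open>t_(k-1)\<close>, while the
  output is that of \<open>s_k\<close>; for even \<open>k\<close> they differ by the symbol of -1,
  negative exactly when \<open>t\<close> is 3 modulo 4.\<close>

fun readout :: "nat \<Rightarrow> state \<Rightarrow> int option" where
  "readout k (m, t, s) =
     (if even t then None else Some (if t = 3 \<and> even k then - s else s))"

text \<open>The determinant identity makes \<open>t\<^sub>k\<^sub>-\<^sub>1\<close> an inverse of \<open>s\<^sub>k\<close> up to sign modulo \<open>t\<^sub>k\<close>,
  so the two have the same symbol up to the character of that sign.\<close>

lemma jac_num_eq_jac_den: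
  assumes "cf_den x k = int m" "cf_den x (Suc k) = int t" "odd t"
  shows "jac (cf_num x (Suc k)) t = (if even k then chi4 t else 1) * jac (int m) t"
proof -
  define u where "u = (if even k then chi4 t else 1)"
  have "[cf_num x (Suc k) * int m = - ((-1) ^ k)] (mod int t)"
  proof -
    have "cf_num x (Suc k) * int m - - ((-1) ^ k) = int t * cf_num x k"
      using cf_determinant[of x k] assms by (simp add: algebra_simps)
    then show ?thesis by (simp add: cong_iff_dvd_diff)
  qed
  then have "jac (cf_num x (Suc k)) t * jac (int m) t = jac (- ((-1) ^ k)) t"
    using jac_cong[OF assms(3)] jac_mult[OF assms(3)] by metis
  also have "\<dots> = u"
    using assms(3) by (cases "even k") (simp_all add: u_def jac_minus_one jac_one_left)
  finally have *: "jac (cf_num x (Suc k)) t * jac (int m) t = u" .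
  have "u \<in> {1, -1}" by (auto simp: u_def chi4_def)
  then have "jac (int m) t \<in> {1, -1}"
    using * by (auto simp: zmult_eq_1_iff zmult_eq_neg1_iff)
  then show ?thesis using * unfolding u_def by auto
qed

lemma jacobi_seq_eq_readout:
  assumes "\<And>k. cf x k = int (a k)"
  shows "jacobi_seq x k = readout k (run (\<lambda>k. a k mod 4) k)"
proof (cases "odd (cden a (Suc k))")
  case True
  then have "odd (cden a (Suc k) mod 4)" by presburger
  then show ?thesis
    using True jac_num_eq_jac_den[OF cf_den_eq_cden[OF assms] cf_den_eq_cden[OF assms] True]
    by (simp add: jacobi_seq_def jacobi_sym_def conv_num_def conv_den_def
        cf_den_eq_cden[OF assms] run_eq_sig sig_def esym_def chi4_def flip: jac_def)
next
  case False
  then have "even (cden a (Suc k) mod 4)" by presburger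
  then show ?thesis
    using False by (simp add: jacobi_seq_def jacobi_sym_def conv_den_def
        cf_den_eq_cden[OF assms] run_eq_sig sig_def)
qed

section \<open>The period\<close>

text \<open>Adding 3 stands for subtracting 1, which would truncate at \<open>r = 0\<close>.\<close>

definition pquot4 :: "nat \<Rightarrow> nat \<Rightarrow> nat" where
  "pquot4 r k = (if k mod 3 = 1 then ((2 * (k div 3) + 1) * r + 3) mod 4 else 1)"

lemma pquot_mod4:
  assumes "n > 0"
  shows "pquot n k mod 4 = pquot4 (n mod 4) k"
proof -
  define q where "q = 2 * (k div 3) + 1"
  have "q * n > 0" using assms by (simp add: q_def)
  then have "q * n + 3 = (q * n - 1) + 4" by simp
  then have "(q * n - 1) mod 4 = (q * n + 3) mod 4" by (simp only: mod_add_self2)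
  also have "\<dots> = (q * (n mod 4) + 3) mod 4"
    by (metis mod_add_left_eq mod_mult_right_eq)
  finally show ?thesis by (simp add: pquot_def pquot4_def q_def)
qed

text \<open>A shift by 24 raises \<open>k div 3\<close> by 8 and so the quotient by
  \<open>16 * r\<close>, which vanishes modulo 4. With equal inputs, one return to the initial state
  repeats forever.\<close>

lemma run_pquot4_periodic:
  assumes "run (pquot4 r) 24 = run (pquot4 r) 0"
  shows "run (pquot4 r) (k + 24) = run (pquot4 r) k"
proof (induction k)
  case 0
  then show ?case using assms by (simp only: add_0)
next
  case (Suc k)
  have div: "(Suc k + 24) div 3 = Suc k div 3 + 8" "(Suc k + 24) mod 3 = Suc k mod 3"
    by presburger+
  have "(2 * (Suc k div 3 + 8) + 1) * r + 3 = (2 * (Suc k div 3) + 1) * r + 3 + 4 * (4 * r)"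
    by (simp add: algebra_simps)
  then have "pquot4 r (Suc k + 24) = pquot4 r (Suc k)"
    unfolding pquot4_def div by (simp only: mod_mult_self2)
  then show ?case using Suc by (simp only: add_Suc run.simps)
qed

text \<open>A known period \<open>N\<close> makes the sequence a cyclic word of length
  \<open>N\<close>, on which a shift by \<open>L\<close> acts as a rotation. Periodicity thus
  becomes a finite check.\<close>

lemma is_period_iff_rotate:
  assumes "\<And>k. c (k + N) = c k" "N > 0"
  shows "is_period c L \<longleftrightarrow> L \<ge> 1 \<and> rotate L (map c [0..<N]) = map c [0..<N]"
proof -
  have shift: "c (k + i * N) = c k" for k i
  proof (induction i)
    case (Suc i)
    then show ?case using assms(1)[of "k + i * N"] by (simp add: add_ac)
  qed simp
  have mod: "c (k mod N) = c k" for k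
    using shift[of "k mod N" "k div N"] by (simp add: mult.commute)
  have "(\<forall>k. c (k + L) = c k) \<longleftrightarrow> (\<forall>k<N. c (k + L) = c k)"
    by (metis assms(2) mod mod_add_left_eq mod_less_divisor)
  also have "\<dots> \<longleftrightarrow> rotate L (map c [0..<N]) = map c [0..<N]"
    by (simp add: list_eq_iff_nth_eq nth_rotate mod add.commute assms(2))
  finally show ?thesis by (simp add: is_period_def)
qed

lemma smallest_period_eqI:
  assumes "\<And>k. c (k + N) = c k" "N > 0"
    and "map c [0..<N] = xs" "rotate P xs = xs" "\<forall>L\<in>set [1..<P]. rotate L xs \<noteq> xs" "P \<ge> 1"
  shows "purely_periodic c \<and> smallest_period c = P"
proof -
  have iff: "is_period c L \<longleftrightarrow> L \<ge> 1 \<and> rotate L xs = xs" for L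
    using is_period_iff_rotate[of c N] assms(1-3) by simp
  then have "is_period c P" using assms(4,6) by simp
  moreover have "smallest_period c = P"
    unfolding smallest_period_def
  proof (rule Least_equality)
    show "P \<le> L" if "is_period c L" for L
      using that assms(5) iff by (fastforce intro: leI)
  qed fact
  ultimately show ?thesis by (auto simp: purely_periodic_def)
qed

section \<open>Evaluation for the four residues of n modulo 4\<close>

lemma run_pquot4_24: "r < 4 \<Longrightarrow> run (pquot4 r) 24 = run (pquot4 r) 0"
proof -
  have "\<forall>r\<in>{0, 1, 2, 3}. run (pquot4 r) 24 = run (pquot4 r) 0" by code_simp
  moreover assume "r < 4"
  then have "r \<in> {0, 1, 2, 3}" by auto
  ultimately show ?thesis by blast
qed

lemma readout_table_0:
  "map (\<lambda>k. readout k (run (pquot4 0) k)) [0..<24] =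
    [Some 1, Some 1, None, Some 1, Some 1, None, Some 1, Some 1, None, Some 1, Some 1, None,
     Some 1, Some 1, None, Some 1, Some 1, None, Some 1, Some 1, None, Some 1, Some 1, None]"
  by code_simp

lemma readout_table_1:
  "map (\<lambda>k. readout k (run (pquot4 1) k)) [0..<24] =
    [Some 1, None, Some 1, Some 1, Some (-1), None, Some (-1), None, Some (-1), Some (-1), Some (-1), None,
     Some (-1), None, Some (-1), Some (-1), Some 1, None, Some 1, None, Some 1, Some 1, Some 1, None]"
  by code_simp

lemma readout_table_2:
  "map (\<lambda>k. readout k (run (pquot4 2) k)) [0..<24] =
    [Some 1, Some 1, None, Some (-1), Some (-1), None, Some (-1), Some (-1), None, Some 1, Some 1, None,
     Some 1, Some 1, None, Some (-1), Some (-1), None, Some (-1), Some (-1), None, Some 1, Some 1, None]"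
  by code_simp

lemma readout_table_3:
  "map (\<lambda>k. readout k (run (pquot4 3) k)) [0..<24] =
    [Some 1, None, Some 1, Some (-1), Some 1, None, Some 1, None, Some (-1), Some (-1), Some (-1), None,
     Some (-1), None, Some (-1), Some 1, Some (-1), None, Some (-1), None, Some 1, Some 1, Some 1, None]"
  by code_simp

theorem theorem4:
  fixes n :: nat
  assumes "n \<ge> 2"
  shows "purely_periodic (jacobi_seq (exp (1 / real n)))
    \<and> smallest_period (jacobi_seq (exp (1 / real n))) =
        (if n mod 4 = 1 \<or> n mod 4 = 3 then 24
         else if n mod 4 = 2 then 12 else 3)"
proof -
  define c where "c r k = readout k (run (pquot4 r) k)" for r k
  have "(\<lambda>k. pquot n k mod 4) = pquot4 (n mod 4)"
    using assms pquot_mod4 by auto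
  then have seq: "jacobi_seq (exp (1 / real n)) = c (n mod 4)"
    using jacobi_seq_eq_readout[OF cf_exp[OF assms]] by (auto simp: c_def)
  \<comment> \<open>The output uses \<open>k\<close> only through its parity, and 24 is
    even.\<close>
  have readout_parity: "readout (k + 24) st = readout k st" for k st
    by (cases st) simp
  have periodic: "c r (k + 24) = c r k" if "r < 4" for r k
    unfolding c_def run_pquot4_periodic[OF run_pquot4_24[OF that]] by (rule readout_parity)
  note readout_table_0 readout_table_1 readout_table_2 readout_table_3
  note table = this[folded c_def]
  have "purely_periodic (c 0) \<and> smallest_period (c 0) = 3"
    \<comment> \<open>Evaluation confirms that rotation by the claimed period fixes the table and
      that no smaller positive rotation does; likewise for the other residues.\<close>
    by (rule smallest_period_eqI[OF periodic _ table(1)]) (simp, simp, code_simp+)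
  moreover have "purely_periodic (c 1) \<and> smallest_period (c 1) = 24"
    by (rule smallest_period_eqI[OF periodic _ table(2)]) (simp, simp, code_simp+)
  moreover have "purely_periodic (c 2) \<and> smallest_period (c 2) = 12"
    by (rule smallest_period_eqI[OF periodic _ table(3)]) (simp, simp, code_simp+)
  moreover have "purely_periodic (c 3) \<and> smallest_period (c 3) = 24"
    by (rule smallest_period_eqI[OF periodic _ table(4)]) (simp, simp, code_simp+)
  moreover have "n mod 4 \<in> {0, 1, 2, 3}" by auto
  ultimately show ?thesis
    unfolding seq by auto
qed

end
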